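(* For every integer $n\ge 0$, the number $E_3(n)$ of generalized vertex model configurations on the generalized two-dimensional Sierpinski gasket $SG_3(n)$ is $$E_3(n)=2^{(8\times 6^n+7)/5},$$ and the entropy per site $S_{E,SG_3}=\lim_{n\to\infty}\frac{\ln E_3(n)}{v(SG_3(n))}$, where $v(SG_3(n))=\frac{7\times 6^n+8}{5}$ is the number of vertices of $SG_3(n)$, equals $\frac87\ln 2$.
   Context: The generalized Sierpinski gasket graphs $SG_3(n)$ (side length $b=3$), $n\ge 0$, are defined recursively. $SG_3(0)$ is a triangle (three vertices, three edges), drawn as an equilateral triangle with bottom side horizontal, with all three vertices called outmost. $SG_3(n+1)$ is obtained by subdividing a larger equilateral triangle (pointing upward) into nine congruent equilateral triangles of one third the side length, placing a copy of $SG_3(n)$ in each of the six upward-pointing small triangles (arranged in layers of 3, 2 and 1), and identifying all outmost vertices of different copies that coincide as points of the plane. The outmost vertices of $SG_3(n+1)$ are the three corners of the large triangle. $SG_3(n)$ has $3\times 6^n$ edges and $\frac{7\times 6^n+8}{5}$ vertices: the three outmost vertices have degree 2, $(6^n-1)/5$ vertices have degree 6, and $6(6^n-1)/5$ vertices have degree 4. A generalized vertex model configuration on $SG_3(n)$ is an assignment of an orientation to every edge such that at every vertex of degree 4 the number of incident edges pointing toward the vertex is even, and at every vertex of degree 6 the number of incident edges pointing toward the vertex is odd. No condition is imposed at the three outmost vertices. $E_3(n)$ is the number of such configurations. *)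

theory Defs
  imports Complex_Main "HOL-Library.FuncSet"
begin

text \<open>
  The pair \<open>(x, y)\<close> stands for the point \<open>x * e1 + y * e2\<close> of the triangular lattice in the plane,
  where \<open>e1\<close> is the horizontal unit vector and \<open>e2\<close> is \<open>e1\<close> rotated by 60 degrees. The graph at
  stage \<open>n\<close> is drawn at scale \<open>3 ^ n\<close>, with outmost vertices \<open>(0, 0)\<close>, \<open>(3 ^ n, 0)\<close> and
  \<open>(0, 3 ^ n)\<close>, so that its edges have unit length; no rescaling is needed in the recursion.
\<close>

type_synonym point = "nat \<times> nat"

text \<open>
  Positions of the lower left corners of the six upward-pointing small triangles, in units of
  their side length (layers of 3, 2 and 1).
\<close>

definition upward_cells :: "point set" where
  "upward_cells = {(0, 0), (1, 0), (2, 0), (0, 1), (1, 1), (0, 2)}"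

fun place :: "nat \<Rightarrow> point \<Rightarrow> point \<Rightarrow> point" where
  "place s (i, j) (x, y) = (s * i + x, s * j + y)"

text \<open>
  Distinct upward-pointing small triangles meet at most in a common corner, so the unions below
  identify precisely the coinciding outmost vertices of different copies, and never two edges.
\<close>

primrec SG3_vertices :: "nat \<Rightarrow> point set" where
  "SG3_vertices 0 = {(0, 0), (1, 0), (0, 1)}"
| "SG3_vertices (Suc n) = (\<Union>c\<in>upward_cells. place (3 ^ n) c ` SG3_vertices n)"

primrec SG3_edges :: "nat \<Rightarrow> point set set" where
  "SG3_edges 0 = {{(0, 0), (1, 0)}, {(0, 0), (0, 1)}, {(1, 0), (0, 1)}}"
| "SG3_edges (Suc n) = (\<Union>c\<in>upward_cells. (\<lambda>e. place (3 ^ n) c ` e) ` SG3_edges n)"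

definition degree :: "'v set set \<Rightarrow> 'v \<Rightarrow> nat" where
  "degree E v = card {e \<in> E. v \<in> e}"

text \<open>
  An orientation selects for each edge the endpoint it points toward; it is \<open>undefined\<close> outside
  the edge set, so that orientations can be counted.
\<close>

definition orientations :: "'v set set \<Rightarrow> ('v set \<Rightarrow> 'v) set" where
  "orientations E = (\<Pi>\<^sub>E e\<in>E. e)"

definition indegree :: "'v set set \<Rightarrow> ('v set \<Rightarrow> 'v) \<Rightarrow> 'v \<Rightarrow> nat" where
  "indegree E h v = card {e \<in> E. v \<in> e \<and> h e = v}"

text \<open>The outmost vertices have degree 2, so they are not constrained.\<close>

definition vertex_configurations :: "'v set \<Rightarrow> 'v set set \<Rightarrow> ('v set \<Rightarrow> 'v) set" where
  "vertex_configurations V E =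
    {h \<in> orientations E. \<forall>v\<in>V.
       (degree E v = 4 \<longrightarrow> even (indegree E h v)) \<and>
       (degree E v = 6 \<longrightarrow> odd (indegree E h v))}"

definition E3 :: "nat \<Rightarrow> nat" where
  "E3 n = card (vertex_configurations (SG3_vertices n) (SG3_edges n))"

end

theory Submission
  imports Defs "HOL-Real_Asymp.Real_Asymp"
begin

text \<open>
  Reversing an edge joining a constrained vertex to an unconstrained one is an involution that
  changes the parity at just one constrained vertex, so lifting the constraint there doubles the
  number of admissible orientations. In a connected graph with at least one unconstrained vertex
  all constraints can be lifted one after the other, whatever the prescribed parities. Hence
  there are \<open>2 ^ (|E| - |S|)\<close> admissible orientations, \<open>S\<close> being the set of constrained vertices;
  in the Sierpinski gasket these are all vertices but the three outmost ones.
\<close>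

section \<open>Counting orientations with prescribed in-degree parities\<close>

lemma indegree_split:
  assumes "finite E" "e \<in> E" "v \<in> e"
  shows "indegree E h v = indegree (E - {e}) h v + of_bool (h e = v)"
proof -
  have "{d \<in> E. v \<in> d \<and> h d = v} =
      {d \<in> E - {e}. v \<in> d \<and> h d = v} \<union> (if h e = v then {e} else {})"
    using assms by auto
  then show ?thesis
    using assms(1) unfolding indegree_def by (simp add: card_Un_disjoint)
qed

lemma indegree_cong:
  assumes "\<And>e. e \<in> E \<Longrightarrow> v \<in> e \<Longrightarrow> h e = h' e"
  shows "indegree E h v = indegree E h' v"
proof -
  have "e \<in> E \<and> v \<in> e \<and> h e = v \<longleftrightarrow> e \<in> E \<and> v \<in> e \<and> h' e = v" for e
    using assms[of e] by metis
  then show ?thesis unfolding indegree_def by simp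
qed

lemma card_orientations:
  assumes "finite E" "\<And>e. e \<in> E \<Longrightarrow> card e = 2"
  shows "card (orientations E) = 2 ^ card E"
  using assms by (simp add: orientations_def card_PiE)

text \<open>\<open>crossing\<close> stands in for connectedness plus an unconstrained vertex. It
  passes to subsets of \<open>S\<close>, so the induction may remove any vertex it likes. The
  product form avoids subtraction on naturals.\<close>

lemma card_orientations_with_parities:
  fixes E :: "'v set set" and t :: "'v \<Rightarrow> bool"
  assumes E: "finite E" "\<And>e. e \<in> E \<Longrightarrow> card e = 2"
    and S: "finite S"
    and crossing: "\<And>T. T \<subseteq> S \<Longrightarrow> T \<noteq> {} \<Longrightarrow> \<exists>e\<in>E. e \<inter> T \<noteq> {} \<and> \<not> e \<subseteq> T"
  shows "card {h \<in> orientations E. \<forall>v\<in>S. even (indegree E h v) = t v} * 2 ^ card S = 2 ^ card E"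
  using S crossing
proof (induction S rule: finite_psubset_induct)
  case (psubset S)
  show ?case
  proof (cases "S = {}")
    case True
    then show ?thesis by (simp add: card_orientations E)
  next
    case False
    \<comment> \<open>Applying \<open>crossing\<close> to all of \<open>S\<close> yields an edge
      from a constrained \<open>v\<close> to an unconstrained \<open>u\<close>; this is the edge to
      reverse.\<close>
    then obtain e u v where e: "e \<in> E" and v: "v \<in> e" "v \<in> S" and u: "u \<in> e" "u \<notin> S"
      using psubset.prems[of S] by blast
    have uv: "u \<noteq> v" and e_eq: "e = {u, v}"
    proof -
      show "u \<noteq> v" using u v by auto
      obtain a b where "e = {a, b}" using E(2)[OF e] by (auto simp: card_2_iff)
      with u v \<open>u \<noteq> v\<close> show "e = {u, v}" by auto
    qed
    define flip where "flip h = h(e := if h e = u then v else u)" for h :: "'v set \<Rightarrow> 'v"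
    \<comment> \<open>\<open>A\<close> lifts the constraint at \<open>v\<close>;
      \<open>B True\<close> and \<open>B False\<close> split it by the parity found there.\<close>
    define A where "A = {h \<in> orientations E. \<forall>w\<in>S - {v}. even (indegree E h w) = t w}"
    define B where "B b = {h \<in> A. even (indegree E h v) = b}" for b
    have finA: "finite A"
      unfolding A_def orientations_def
      by (rule finite_subset[OF _ finite_PiE[of E "\<lambda>e. e"]]) (use E in \<open>auto intro: card_ge_0_finite\<close>)
    have h_e: "h e = u \<or> h e = v" if "h \<in> A" for h
      using that e e_eq by (auto simp: A_def orientations_def PiE_def Pi_def)
    have rest: "indegree (E - {e}) (flip h) w = indegree (E - {e}) h w" for h w
      by (rule indegree_cong) (auto simp: flip_def)
    have flip_v: "even (indegree E (flip h) v) \<longleftrightarrow> odd (indegree E h v)" if "h \<in> A" for h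
      using h_e[OF that] uv unfolding indegree_split[OF E(1) e v(1)] rest by (auto simp: flip_def)
    \<comment> \<open>Only \<open>u\<close> and \<open>v\<close> see the change at \<open>e\<close>,
      and \<open>u\<close> lies outside \<open>S\<close>, so every other constraint survives the
      flip.\<close>
    have flip_w: "indegree E (flip h) w = indegree E h w" if "w \<in> S - {v}" for h w
      by (rule indegree_cong) (use that u e_eq in \<open>auto simp: flip_def\<close>)
    have flip_or: "flip h \<in> orientations E" if "h \<in> orientations E" for h
      using that e u v by (auto simp: flip_def orientations_def PiE_def Pi_def extensional_def)
    have flip_B: "flip h \<in> B (\<not> b)" if "h \<in> B b" for h b
      using that flip_or flip_v flip_w by (auto simp: A_def B_def)
    have flip_flip: "flip (flip h) = h" if "h \<in> A" for h
      using h_e[OF that] uv by (auto simp: flip_def)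
    have "bij_betw flip (B True) (B False)"
      by (rule bij_betw_byWitness[where f' = flip])
        (use flip_flip flip_B[of _ True] flip_B[of _ False] in \<open>auto simp: B_def\<close>)
    then have "card (B True) = card (B False)"
      by (rule bij_betw_same_card)
    moreover have "card A = card (B True) + card (B False)"
    proof -
      have "A = B True \<union> B False" by (auto simp: B_def)
      moreover have "B True \<inter> B False = {}" by (auto simp: B_def)
      ultimately show ?thesis
        using finA by (metis card_Un_disjoint finite_Un)
    qed
    ultimately have "card A = 2 * card (B (t v))"
      by (cases "t v") auto
    moreover have "B (t v) = {h \<in> orientations E. \<forall>w\<in>S. even (indegree E h w) = t w}"
      using v by (auto simp: A_def B_def)
    moreover have "card A * 2 ^ card (S - {v}) = 2 ^ card E"
      unfolding A_def
    proof (rule psubset.IH)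
      fix T assume "T \<subseteq> S - {v}" "T \<noteq> {}"
      then show "\<exists>e\<in>E. e \<inter> T \<noteq> {} \<and> \<not> e \<subseteq> T"
        by (intro psubset.prems) auto
    qed (use v in auto)
    moreover have "card S = Suc (card (S - {v}))"
      using v psubset.hyps by (intro card.remove) auto
    ultimately show ?thesis by simp
  qed
qed

section \<open>Overlaps of translated triangles\<close>

definition triangle :: "nat \<Rightarrow> point set" where
  "triangle s = {(x, y). x + y \<le> s}"

definition corners :: "nat \<Rightarrow> point set" where
  "corners s = {(0, 0), (s, 0), (0, s)}"

text \<open>These turn out to be the constrained vertices. Vertices on the sides of the large
  triangle belong here too; only the three outmost ones are left out.\<close>

abbreviation SG3_interior :: "nat \<Rightarrow> point set" where
  "SG3_interior n \<equiv> SG3_vertices n - corners (3 ^ n)"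

lemma place_eq_iff [simp]: "place s c p = place s c q \<longleftrightarrow> p = q"
  by (cases c; cases p; cases q) auto

lemma inj_place: "inj (place s c)"
  by (simp add: inj_def)

text \<open>The first equation forces \<open>x\<close> to be at least \<open>s\<close>, hence
  \<open>x = s\<close>, \<open>y = 0\<close> and \<open>x' = 0\<close>. Then \<open>y'\<close> is a
  multiple of \<open>s\<close> between \<open>0\<close> and \<open>s\<close>, and comparing
  \<open>j\<close> with \<open>j'\<close> decides which.\<close>

lemma overlap_axis:
  fixes s i i' j j' :: nat
  assumes "s * i + x = s * i' + x'" "s * j + y = s * j' + y'" "i < i'"
    "x + y \<le> s" "x' + y' \<le> s" "s > 0"
  shows "x = s \<and> y = 0 \<and> x' = 0 \<and> y' = (if j = j' then 0 else s)"
proof -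
  obtain k where k: "i' = Suc (i + k)" using assms(3) less_imp_Suc_add by blast
  have x: "x = s" "y = 0" "x' = 0"
    using assms unfolding k by (auto simp: algebra_simps)
  moreover have "y' = (if j = j' then 0 else s)"
  proof (cases "j = j'")
    case False
    then have "j' < j" using assms(2,6) x(2)
      by (metis add.right_neutral le_add1 mult_less_mono2 linorder_not_le nat_neq_iff)
    then obtain l where l: "j = Suc (j' + l)" using less_imp_Suc_add by blast
    show ?thesis using False assms(2,5) x unfolding l by (auto simp: algebra_simps)
  qed (use assms(2) x in auto)
  ultimately show ?thesis by blast
qed

lemma overlap_axis':
  fixes s i j j' :: nat
  assumes "x = x'" "s * j + y = s * j' + y'" "j < j'"
    "x + y \<le> s" "x' + y' \<le> s" "s > 0"
  shows "x = 0 \<and> y = s \<and> x' = 0 \<and> y' = 0"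
proof -
  obtain k where k: "j' = Suc (j + k)" using assms(3) less_imp_Suc_add by blast
  show ?thesis
    using assms unfolding k by (auto simp: algebra_simps)
qed

text \<open>The coordinates of a common point depend on the two cells alone, so \<open>p0\<close>
  can be chosen before \<open>p\<close> and \<open>p'\<close>. This gives two facts at once: copies
  meet in at most one point, and that point is a corner.\<close>

lemma place_overlap:
  assumes "s > 0" "c \<noteq> c'"
  shows "\<exists>p0\<in>corners s. \<forall>p\<in>triangle s. \<forall>p'\<in>triangle s. place s c p = place s c' p' \<longrightarrow> p = p0"
proof -
  obtain i j i' j' where c: "c = (i, j)" "c' = (i', j')" by (metis surj_pair)
  have "\<exists>a b. (a, b) \<in> corners s \<and> (\<forall>x y x' y'. x + y \<le> s \<longrightarrow> x' + y' \<le> s \<longrightarrow>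
      s * i + x = s * i' + x' \<longrightarrow> s * j + y = s * j' + y' \<longrightarrow> x = a \<and> y = b)"
  proof -
    consider "i < i'" | "i' < i" | "i = i'" "j < j'" | "i = i'" "j' < j"
      using assms(2) c by fastforce
    then show ?thesis
    proof cases
      case 1
      show ?thesis
        by (rule exI[of _ s], rule exI[of _ 0], intro conjI allI impI)
          (use overlap_axis[OF _ _ 1 _ _ assms(1)] in \<open>simp_all add: corners_def\<close>)
    next
      case 2
      show ?thesis
        \<comment> \<open>The cells swap roles here, so the witness is the point
          \<open>(x', y')\<close> of \<open>overlap_axis\<close>.\<close>
        by (rule exI[of _ 0], rule exI[of _ "if j' = j then 0 else s"], intro conjI allI impI)
          (use overlap_axis[OF sym sym 2 _ _ assms(1)] in \<open>simp_all add: corners_def\<close>)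
    next
      case 3
      show ?thesis
        by (rule exI[of _ 0], rule exI[of _ s], intro conjI allI impI)
          (use overlap_axis'[OF _ _ 3(2) _ _ assms(1)] 3 in \<open>simp_all add: corners_def\<close>)
    next
      case 4
      show ?thesis
        by (rule exI[of _ 0], rule exI[of _ 0], intro conjI allI impI)
          (use overlap_axis'[OF _ sym 4(2) _ _ assms(1)] 4 in \<open>simp_all add: corners_def\<close>)
    qed
  qed
  then show ?thesis
    by (auto simp: c triangle_def intro!: bexI)
qed

text \<open>The points \<open>place s d (0, 0)\<close> form the lattice of spacing \<open>s\<close>,
  where \<open>d\<close> need not be an upward cell. Each is the lower left corner of the triangle
  placed at \<open>d\<close>, so the overlap analysis applies.\<close>

lemma place_eq_place_corner:
  assumes "s > 0" "p \<in> triangle s" "place s c p = place s d (0, 0)"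
  shows "p \<in> corners s"
proof (cases "c = d")
  case True
  with assms show ?thesis by (auto simp: corners_def)
next
  case False
  have "(0, 0) \<in> triangle s" by (simp add: triangle_def)
  with place_overlap[OF assms(1) False] assms(2,3) show ?thesis by metis
qed

section \<open>Vertices, edges and connectedness of the gasket\<close>

lemma finite_upward_cells [simp]: "finite upward_cells"
  by (simp add: upward_cells_def)

lemma card_upward_cells: "card upward_cells = 6"
  by (simp add: upward_cells_def)

lemma finite_SG3 [simp]: "finite (SG3_vertices n)" "finite (SG3_edges n)"
  by (induction n) auto

lemma SG3_vertices_subset_triangle: "SG3_vertices n \<subseteq> triangle (3 ^ n)"
proof (induction n)
  case (Suc n)
  then show ?case
    by (fastforce simp: upward_cells_def triangle_def)
qed (auto simp: triangle_def)

lemma corners_subset_SG3_vertices: "corners (3 ^ n) \<subseteq> SG3_vertices n"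
proof (induction n)
  case (Suc n)
  have cells: "(0, 0) \<in> upward_cells" "(2, 0) \<in> upward_cells" "(0, 2) \<in> upward_cells"
    by (simp_all add: upward_cells_def)
  have corner: "(0, 0) \<in> corners (3 ^ n)" "(3 ^ n, 0) \<in> corners (3 ^ n)" "(0, 3 ^ n) \<in> corners (3 ^ n)"
    by (simp_all add: corners_def)
  have "place (3 ^ n) (0, 0) (0, 0) \<in> SG3_vertices (Suc n)"
    "place (3 ^ n) (2, 0) (3 ^ n, 0) \<in> SG3_vertices (Suc n)"
    "place (3 ^ n) (0, 2) (0, 3 ^ n) \<in> SG3_vertices (Suc n)"
    using Suc unfolding SG3_vertices.simps
    using cells corner by blast+
  then show ?case by (simp add: corners_def)
qed (simp add: corners_def)

lemma card_corners: "s > 0 \<Longrightarrow> card (corners s) = 3"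
  by (simp add: corners_def)

lemma SG3_edges_subset: "e \<in> SG3_edges n \<Longrightarrow> e \<subseteq> SG3_vertices n"
proof (induction n arbitrary: e)
  case (Suc n)
  then obtain c d where "c \<in> upward_cells" "d \<in> SG3_edges n" "e = place (3 ^ n) c ` d" by auto
  with Suc.IH[of d] show ?case by auto
qed auto

lemma card_SG3_edge: "e \<in> SG3_edges n \<Longrightarrow> card e = 2"
proof (induction n arbitrary: e)
  case (Suc n)
  then show ?case by (auto simp: card_image inj_on_subset[OF inj_place])
qed auto

text \<open>A common edge would have both endpoints in the overlap of two copies, which has at most
  one point.\<close>

lemma place_edges_disjoint:
  assumes "c \<noteq> c'" "e \<in> SG3_edges n" "e' \<in> SG3_edges n"
  shows "place (3 ^ n) c ` e \<noteq> place (3 ^ n) c' ` e'"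
proof
  assume eq: "place (3 ^ n) c ` e = place (3 ^ n) c' ` e'"
  obtain p0 where p0: "\<And>p p'. \<lbrakk>p \<in> triangle (3 ^ n); p' \<in> triangle (3 ^ n);
      place (3 ^ n) c p = place (3 ^ n) c' p'\<rbrakk> \<Longrightarrow> p = p0"
    using place_overlap[OF _ assms(1), of "3 ^ n"] by auto
  have "p = p0" if "p \<in> e" for p
  proof -
    from that eq obtain p' where "p' \<in> e'" "place (3 ^ n) c p = place (3 ^ n) c' p'" by blast
    with that p0 assms SG3_edges_subset SG3_vertices_subset_triangle show ?thesis by blast
  qed
  then have "e \<subseteq> {p0}" by blast
  then have "card e \<le> 1" using card_mono[of "{p0}" e] by simp
  with card_SG3_edge[OF assms(2)] show False by simp
qed

lemma place_edge_sets_disjoint: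
  assumes "A \<subseteq> SG3_edges n" "B \<subseteq> SG3_edges n" "c \<noteq> c'"
  shows "(\<lambda>e. place (3 ^ n) c ` e) ` A \<inter> (\<lambda>e. place (3 ^ n) c' ` e) ` B = {}"
  using place_edges_disjoint[OF assms(3)] assms(1,2) by blast

lemma inj_on_place_edges: "inj_on (\<lambda>e. place s c ` e) A"
  using inj_place by (simp add: inj_on_def inj_image_eq_iff)

lemma card_SG3_edges: "card (SG3_edges n) = 3 * 6 ^ n"
proof (induction n)
  case (Suc n)
  have "card (SG3_edges (Suc n)) =
      (\<Sum>c\<in>upward_cells. card ((\<lambda>e. place (3 ^ n) c ` e) ` SG3_edges n))"
    unfolding SG3_edges.simps
    by (intro card_UN_disjoint ballI impI place_edge_sets_disjoint) auto
  also have "\<dots> = 6 * card (SG3_edges n)"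
    by (simp add: card_image inj_on_place_edges card_upward_cells)
  finally show ?case using Suc by simp
qed (simp add: doubleton_eq_iff)

text \<open>Edges of different copies are distinct, so degrees add up. Keeping \<open>v\<close> in
  global coordinates lets copies that miss \<open>v\<close> contribute zero.\<close>

lemma degree_SG3_Suc:
  "degree (SG3_edges (Suc n)) v =
    (\<Sum>c\<in>upward_cells. card {e \<in> SG3_edges n. v \<in> place (3 ^ n) c ` e})"
proof -
  have "{e \<in> SG3_edges (Suc n). v \<in> e} =
      (\<Union>c\<in>upward_cells. (\<lambda>e. place (3 ^ n) c ` e) ` {e \<in> SG3_edges n. v \<in> place (3 ^ n) c ` e})"
    by auto
  then have "degree (SG3_edges (Suc n)) v =
      (\<Sum>c\<in>upward_cells. card ((\<lambda>e. place (3 ^ n) c ` e) ` {e \<in> SG3_edges n. v \<in> place (3 ^ n) c ` e}))"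
    unfolding degree_def
    by (simp only:) (intro card_UN_disjoint ballI impI place_edge_sets_disjoint; auto)
  then show ?thesis
    by (simp add: card_image inj_on_place_edges)
qed

text \<open>Connectedness is expressed by functions constant along edges instead of paths: composing
  such a function with \<open>place\<close> gives one on the smaller graph, which suits the
  recursion.\<close>

lemma connected_SG3:
  assumes "\<And>e u v. e \<in> SG3_edges n \<Longrightarrow> u \<in> e \<Longrightarrow> v \<in> e \<Longrightarrow> f u = f v"
    and "v \<in> SG3_vertices n"
  shows "f v = f (0, 0)"
  using assms
proof (induction n arbitrary: f v)
  case 0
  show ?case
    using 0(2) 0(1)[of "{(0,0),(1,0)}" "(0,0)" "(1,0)"] 0(1)[of "{(0,0),(0,1)}" "(0,0)" "(0,1)"]
    by auto
next
  case (Suc n)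
  let ?s = "3 ^ n"
  have copy: "f (place ?s c p) = f (place ?s c (0, 0))"
    if c: "c \<in> upward_cells" and p: "p \<in> SG3_vertices n" for c p
  proof (rule Suc.IH[of "\<lambda>p. f (place ?s c p)", OF _ p])
    fix e u v assume "e \<in> SG3_edges n" "u \<in> e" "v \<in> e"
    with c show "f (place ?s c u) = f (place ?s c v)"
      by (intro Suc.prems(1)[of "place ?s c ` e"]) auto
  qed
  have "f (place ?s c (?s, 0)) = f (place ?s c (0, 0))" "f (place ?s c (0, ?s)) = f (place ?s c (0, 0))"
    if "c \<in> upward_cells" for c
    by (intro copy that subsetD[OF corners_subset_SG3_vertices]; simp add: corners_def)+
  \<comment> \<open>Cell \<open>(0, 0)\<close> reaches the origins of \<open>(1, 0)\<close> and
    \<open>(0, 1)\<close>; from these, \<open>(2, 0)\<close>, \<open>(1, 1)\<close> and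
    \<open>(0, 2)\<close> are reached.\<close>
  from this[of "(0, 0)"] this[of "(1, 0)"] this[of "(0, 1)"]
  have "f (place ?s c (0, 0)) = f (0, 0)" if "c \<in> upward_cells" for c
    using that by (auto simp: upward_cells_def mult_2_right)
  moreover obtain c p where "c \<in> upward_cells" "p \<in> SG3_vertices n" "v = place ?s c p"
    using Suc.prems(2) by auto
  ultimately show ?case using copy[of c p] by simp
qed

section \<open>Recursive decomposition of the vertex set\<close>

text \<open>The ten corners of the six cells, in units of the cell side: the three outmost vertices
  (\<open>corners 3\<close>) and the seven points where copies are glued.\<close>

definition lattice_points :: "point set" where
  "lattice_points =
    {(0, 0), (1, 0), (2, 0), (3, 0), (0, 1), (1, 1), (2, 1), (0, 2), (1, 2), (0, 3)}"

lemma lattice_points_eq: "lattice_points = (\<Union>c\<in>upward_cells. place 1 c ` corners 1)"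
  unfolding lattice_points_def upward_cells_def corners_def
  by (simp del: One_nat_def) blast

lemma place_origin_inj: "s > 0 \<Longrightarrow> place s c (0, 0) = place s d (0, 0) \<longleftrightarrow> c = d"
  by (cases c; cases d) auto

text \<open>The corner \<open>(s * a, s * b)\<close> of copy \<open>c\<close> is \<open>s\<close>
  times the unit-scale point \<open>place 1 c (a, b)\<close>. Questions about corners thus become
  finite checks independent of \<open>n\<close>.\<close>

lemma place_corners: "place s c ` corners s = (\<lambda>d. place s d (0, 0)) ` place 1 c ` corners 1"
  by (cases c) (auto simp: corners_def)

lemma SG3_interior_not_origin:
  assumes "p \<in> SG3_interior n"
  shows "place (3 ^ n) c p \<noteq> place (3 ^ n) d (0, 0)"
  using assms place_eq_place_corner[of "3 ^ n" p c d] SG3_vertices_subset_triangle[of n] by auto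

lemma SG3_interior_not_other_copy:
  assumes "c \<noteq> c'" "p \<in> SG3_interior n"
  shows "place (3 ^ n) c p \<notin> place (3 ^ n) c' ` SG3_vertices n"
proof
  assume "place (3 ^ n) c p \<in> place (3 ^ n) c' ` SG3_vertices n"
  then obtain q where q: "q \<in> SG3_vertices n" "place (3 ^ n) c p = place (3 ^ n) c' q" by blast
  obtain p0 where p0: "p0 \<in> corners (3 ^ n)" "\<forall>p\<in>triangle (3 ^ n). \<forall>p'\<in>triangle (3 ^ n).
      place (3 ^ n) c p = place (3 ^ n) c' p' \<longrightarrow> p = p0"
    using place_overlap[OF _ assms(1), of "3 ^ n"] by auto
  have "p \<in> triangle (3 ^ n)" "q \<in> triangle (3 ^ n)"
    using SG3_vertices_subset_triangle q(1) assms(2) by blast+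
  with p0(2) q(2) have "p = p0" by blast
  with p0(1) assms(2) show False by blast
qed

text \<open>Copies are glued only at corners; indexing those by \<open>lattice_points\<close> lists
  each identified vertex once.\<close>

lemma SG3_vertices_Suc:
  "SG3_vertices (Suc n) = (\<Union>c\<in>upward_cells. place (3 ^ n) c ` SG3_interior n) \<union>
     (\<lambda>d. place (3 ^ n) d (0, 0)) ` lattice_points"
proof -
  have "SG3_vertices n = SG3_interior n \<union> corners (3 ^ n)"
    using corners_subset_SG3_vertices by blast
  then have "SG3_vertices (Suc n) =
      (\<Union>c\<in>upward_cells. place (3 ^ n) c ` SG3_interior n \<union> place (3 ^ n) c ` corners (3 ^ n))"
    unfolding SG3_vertices.simps image_Un[symmetric] by simp
  then show ?thesis
    unfolding place_corners[of "3 ^ n"] lattice_points_eq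
    by (simp only: UN_Un_distrib image_UN)
qed

lemma corners_Suc: "corners (3 ^ Suc n) = (\<lambda>d. place (3 ^ n) d (0, 0)) ` corners 3"
  by (simp add: corners_def mult.commute)

lemma SG3_interior_Suc:
  "SG3_interior (Suc n) = (\<Union>c\<in>upward_cells. place (3 ^ n) c ` SG3_interior n) \<union>
     (\<lambda>d. place (3 ^ n) d (0, 0)) ` (lattice_points - corners 3)"
proof -
  let ?P = "\<lambda>d. place (3 ^ n) d (0, 0)"
  have "inj ?P" by (simp add: inj_def place_origin_inj)
  then have "?P ` (lattice_points - corners 3) = ?P ` lattice_points - ?P ` corners 3"
    by (rule image_set_diff)
  moreover have "(\<Union>c\<in>upward_cells. place (3 ^ n) c ` SG3_interior n) \<inter> ?P ` corners 3 = {}"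
    using SG3_interior_not_origin by (auto simp del: place.simps)
  ultimately show ?thesis
    unfolding SG3_vertices_Suc[of n] corners_Suc by (simp only: Un_Diff Diff_triv)
qed

text \<open>The count \<open>a\<close> starts at 0 and satisfies
  \<open>a (Suc n) = 6 * a n + 7\<close>, the 7 being the ten lattice points minus three outmost
  ones. Hence \<open>5 * a n + 7\<close> is multiplied by 6 at each stage.\<close>

lemma card_SG3_interior: "5 * card (SG3_interior n) + 7 = 7 * 6 ^ n"
proof (induction n)
  case (Suc n)
  let ?P = "\<lambda>d. place (3 ^ n) d (0, 0)"
  have disj: "place (3 ^ n) c ` SG3_interior n \<inter> place (3 ^ n) c' ` SG3_interior n = {}"
    if "c \<noteq> c'" for c c'
    using SG3_interior_not_other_copy[OF that] by blast
  have "card (SG3_interior (Suc n)) =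
      card (\<Union>c\<in>upward_cells. place (3 ^ n) c ` SG3_interior n) + card (?P ` (lattice_points - corners 3))"
    unfolding SG3_interior_Suc
  proof (rule card_Un_disjoint)
    show "(\<Union>c\<in>upward_cells. place (3 ^ n) c ` SG3_interior n) \<inter> ?P ` (lattice_points - corners 3) = {}"
      using SG3_interior_not_origin by (auto simp del: place.simps)
  qed (simp_all add: lattice_points_def del: place.simps)
  also have "card (?P ` (lattice_points - corners 3)) = card (lattice_points - corners 3)"
    by (rule card_image) (simp add: inj_on_def place_origin_inj)
  also have "card (lattice_points - corners 3) = 7"
    by (simp add: lattice_points_def corners_def insert_Diff_if)
  also have "card (\<Union>c\<in>upward_cells. place (3 ^ n) c ` SG3_interior n) =
      (\<Sum>c\<in>upward_cells. card (place (3 ^ n) c ` SG3_interior n))"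
    using disj by (intro card_UN_disjoint) auto
  also have "\<dots> = 6 * card (SG3_interior n)"
    by (simp add: card_image inj_on_subset[OF inj_place] card_upward_cells)
  finally show ?case using Suc by simp
qed (simp add: corners_def)

section \<open>Vertex degrees\<close>

lemma card_edges_in_copy:
  "card {e \<in> SG3_edges n. place s c p \<in> place s c ` e} = degree (SG3_edges n) p"
  unfolding degree_def by (simp add: inj_image_mem_iff[OF inj_place])

lemma card_edges_in_other_copy:
  assumes "v \<notin> place s c ` SG3_vertices n"
  shows "card {e \<in> SG3_edges n. v \<in> place s c ` e} = 0"
proof -
  have "{e \<in> SG3_edges n. v \<in> place s c ` e} = {}"
    using assms SG3_edges_subset by blast
  then show ?thesis by simp
qed

lemma degree_SG3_copy:
  assumes "c \<in> upward_cells" "p \<in> SG3_interior n"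
  shows "degree (SG3_edges (Suc n)) (place (3 ^ n) c p) = degree (SG3_edges n) p"
proof -
  have other: "card {e \<in> SG3_edges n. place (3 ^ n) c p \<in> place (3 ^ n) c' ` e} = 0" if "c' \<noteq> c" for c'
    by (intro card_edges_in_other_copy SG3_interior_not_other_copy that[symmetric] assms)
  show ?thesis
    unfolding degree_SG3_Suc sum.remove[OF finite_upward_cells assms(1)] card_edges_in_copy
    using other by simp
qed

text \<open>Every copy with a corner at this point adds the outmost degree 2. Taking that degree as
  an assumption lets the lemma serve inside the induction for outmost vertices as well as after
  it.\<close>

lemma degree_SG3_lattice_point:
  assumes "\<And>p. p \<in> corners (3 ^ n) \<Longrightarrow> degree (SG3_edges n) p = 2"
  shows "degree (SG3_edges (Suc n)) (place (3 ^ n) d (0, 0)) =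
    (\<Sum>c\<in>upward_cells. if d \<in> place 1 c ` corners 1 then 2 else 0)"
  unfolding degree_SG3_Suc
proof (rule sum.cong[OF refl])
  fix c
  let ?v = "place (3 ^ n) d (0, 0)"
  have iff: "?v \<in> place (3 ^ n) c ` corners (3 ^ n) \<longleftrightarrow> d \<in> place 1 c ` corners 1"
    unfolding place_corners[of "3 ^ n"] by (auto simp: place_origin_inj)
  show "card {e \<in> SG3_edges n. ?v \<in> place (3 ^ n) c ` e} =
      (if d \<in> place 1 c ` corners 1 then 2 else 0)"
  proof (cases "d \<in> place 1 c ` corners 1")
    case True
    then obtain p where p: "p \<in> corners (3 ^ n)" "?v = place (3 ^ n) c p"
      using iff by blast
    show ?thesis
      unfolding p(2) card_edges_in_copy using True assms[OF p(1)] by simp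
  next
    case False
    have "?v \<notin> place (3 ^ n) c ` SG3_vertices n"
    proof
      assume "?v \<in> place (3 ^ n) c ` SG3_vertices n"
      then obtain p where p: "p \<in> SG3_vertices n" "?v = place (3 ^ n) c p" by blast
      then have "p \<in> corners (3 ^ n)"
        using place_eq_place_corner[of "3 ^ n" p c d] SG3_vertices_subset_triangle[of n] by auto
      with p iff False show False by blast
    qed
    from card_edges_in_other_copy[OF this] False show ?thesis by simp
  qed
qed

lemma degree_SG3_corner: "p \<in> corners (3 ^ n) \<Longrightarrow> degree (SG3_edges n) p = 2"
proof (induction n arbitrary: p)
  case 0
  show ?case using 0
    unfolding degree_def corners_def
    by (auto simp: Collect_conj_eq insert_Collect conj_disj_distribR doubleton_eq_iff
        Collect_disj_eq card_insert_if)
next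
  case (Suc n)
  from Suc.prems obtain d where d: "p = place (3 ^ n) d (0, 0)" "d \<in> corners 3"
    unfolding corners_Suc by blast
  have "degree (SG3_edges (Suc n)) p =
      (\<Sum>c\<in>upward_cells. if d \<in> place 1 c ` corners 1 then 2 else 0)"
    unfolding d(1) by (rule degree_SG3_lattice_point) (fact Suc.IH)
  with d(2) show ?case by (auto simp del: SG3_edges.simps simp: corners_def upward_cells_def)
qed

lemma degree_SG3_interior:
  "p \<in> SG3_interior n \<Longrightarrow> degree (SG3_edges n) p = 4 \<or> degree (SG3_edges n) p = 6"
proof (induction n arbitrary: p)
  case 0
  then show ?case by (simp add: corners_def)
next
  case (Suc n)
  then consider c q where "c \<in> upward_cells" "q \<in> SG3_interior n" "p = place (3 ^ n) c q"
    | d where "d \<in> lattice_points - corners 3" "p = place (3 ^ n) d (0, 0)"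
    unfolding SG3_interior_Suc by blast
  then show ?case
  proof cases
    case 1
    then show ?thesis using Suc.IH degree_SG3_copy by metis
  next
    case 2
    \<comment> \<open>Among the seven gluing points, \<open>(1, 1)\<close> is a corner of three
      cells and gets degree 6; the other six are corners of two cells and get degree 4.\<close>
    have "degree (SG3_edges (Suc n)) p =
        (\<Sum>c\<in>upward_cells. if d \<in> place 1 c ` corners 1 then 2 else 0)"
      unfolding 2(2) by (rule degree_SG3_lattice_point) (fact degree_SG3_corner)
    with 2(1) show ?thesis
      by (auto simp del: SG3_edges.simps simp: lattice_points_def corners_def upward_cells_def)
  qed
qed

section \<open>The number of configurations and the entropy\<close>

text \<open>Interior degrees are 4 or 6 and outmost degrees are 2, so the two implications merge
  into one prescribed parity at each interior vertex.\<close>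

lemma vertex_configurations_SG3:
  "vertex_configurations (SG3_vertices n) (SG3_edges n) =
    {h \<in> orientations (SG3_edges n). \<forall>v\<in>SG3_interior n.
      even (indegree (SG3_edges n) h v) = (degree (SG3_edges n) v = 4)}"
proof -
  have "(degree (SG3_edges n) v = 4 \<longrightarrow> even k) \<and> (degree (SG3_edges n) v = 6 \<longrightarrow> odd k) \<longleftrightarrow>
      (v \<in> SG3_interior n \<longrightarrow> even k = (degree (SG3_edges n) v = 4))"
    if "v \<in> SG3_vertices n" for v k
    using that degree_SG3_interior[of v n] degree_SG3_corner[of v n] by auto
  then show ?thesis
    unfolding vertex_configurations_def by blast
qed

lemma E3_mult_power: "E3 n * 2 ^ card (SG3_interior n) = 2 ^ (3 * 6 ^ n)"
  unfolding E3_def vertex_configurations_SG3 card_SG3_edges[symmetric]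
proof (rule card_orientations_with_parities)
  fix T assume T: "T \<subseteq> SG3_interior n" "T \<noteq> {}"
  show "\<exists>e\<in>SG3_edges n. e \<inter> T \<noteq> {} \<and> \<not> e \<subseteq> T"
  proof (rule ccontr)
    assume "\<not> ?thesis"
    \<comment> \<open>Without an edge leaving \<open>T\<close>, its indicator is constant along
      edges, hence on all vertices. But \<open>T\<close> is nonempty and misses the outmost vertex
      \<open>(0, 0)\<close>.\<close>
    then have "u \<in> T \<longleftrightarrow> v \<in> T" if "e \<in> SG3_edges n" "u \<in> e" "v \<in> e" for e u v
      using that by blast
    then have "v \<in> T \<longleftrightarrow> (0, 0) \<in> T" if "v \<in> SG3_vertices n" for v
      using connected_SG3[of n "\<lambda>v. v \<in> T" v] that by blast
    with T show False by (auto simp: corners_def)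
  qed
qed (auto simp: card_SG3_edge)

lemma card_SG3_interior_real: "real (card (SG3_interior n)) = (7 * 6 ^ n - 7) / 5"
proof -
  have "real (5 * card (SG3_interior n) + 7) = real (7 * 6 ^ n)"
    by (simp only: card_SG3_interior)
  then show ?thesis by simp
qed

lemma E3_eq: "real (E3 n) = 2 powr ((8 * 6 ^ n + 7) / 5)"
proof -
  have "real (E3 n) * 2 powr real (card (SG3_interior n)) = 2 powr real (3 * 6 ^ n)"
    unfolding powr_realpow[of 2, simplified]
    using arg_cong[OF E3_mult_power[of n], of real] by simp
  then have "real (E3 n) = 2 powr (real (3 * 6 ^ n) - real (card (SG3_interior n)))"
    by (simp add: powr_diff field_simps)
  also have "real (3 * 6 ^ n) - real (card (SG3_interior n)) = (8 * 6 ^ n + 7) / 5"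
    by (simp add: card_SG3_interior_real field_simps)
  finally show ?thesis .
qed

lemma card_SG3_vertices: "real (card (SG3_vertices n)) = (7 * 6 ^ n + 8) / 5"
proof -
  have "card (SG3_vertices n) = card (SG3_interior n) + card (corners (3 ^ n))"
    using corners_subset_SG3_vertices[of n]
    by (metis card_Diff_subset card_mono finite_SG3(1) finite_subset le_add_diff_inverse2)
  then show ?thesis
    by (simp add: card_SG3_interior_real card_corners field_simps)
qed

theorem proposition6p1:
  "(\<forall>n. real (E3 n) = 2 powr ((8 * 6 ^ n + 7) / 5)) \<and>
   (\<forall>n. real (card (SG3_vertices n)) = (7 * 6 ^ n + 8) / 5) \<and>
   (\<lambda>n. ln (real (E3 n)) / real (card (SG3_vertices n))) \<longlonglongrightarrow> 8 / 7 * ln 2"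
proof (intro conjI allI)
  \<comment> \<open>The logarithm of \<open>E3 n\<close> is its exponent times \<open>ln 2\<close>;
    the leading coefficients \<open>8 / 5\<close> and \<open>7 / 5\<close> give the limit.\<close>
  have "(\<lambda>n. (8 * 6 ^ n + 7) / 5 * ln 2 / ((7 * 6 ^ n + 8) / 5) :: real) \<longlonglongrightarrow> 8 / 7 * ln 2"
    by real_asymp
  then show "(\<lambda>n. ln (real (E3 n)) / real (card (SG3_vertices n))) \<longlonglongrightarrow> 8 / 7 * ln 2"
    by (simp add: E3_eq card_SG3_vertices ln_powr)
qed (fact E3_eq card_SG3_vertices)+

end
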